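(* Fix $m\ge1$. Then the discrete Coagulation-Fragmentation equation with kernels $a(j,k)=jk$ and $b(j,k)=1$ does not admit a stationary solution $\tilde\rho:\mathbb{N}\to[0,\infty)$ such that $\sum_{l=1}^\infty l\tilde\rho(l)=m$.
   Context: Here $\mathbb{N}=\{1,2,3,\dots\}$. The discrete Coagulation-Fragmentation equation with kernels $a(j,k)=jk$, $b(j,k)=1$ is, for $j\in\mathbb{N}$, $t>0$, $$\rho_t(j,t)=\frac12\sum_{k=1}^{j-1}(j-k)k\,\rho(j-k,t)\rho(k,t)-\rho(j,t)\sum_{k=1}^\infty jk\,\rho(k,t)-\frac12(j-1)\rho(j,t)+\sum_{k=1}^\infty\rho(j+k,t).$$ A function $\rho:\mathbb{N}\times[0,\infty)\to[0,\infty)$ is called a solution if for every bounded $g:\mathbb{N}\to\mathbb{R}$, $$\frac{d}{dt}\sum_{j=1}^\infty g(j)\rho(j,t)=\frac12\sum_{j=1}^\infty\sum_{k=1}^\infty\big(g(j+k)-g(j)-g(k)\big)jk\,\rho(j,t)\rho(k,t)-\frac12\sum_{j=1}^\infty\sum_{k=1}^{j-1}\big(g(j)-g(k)-g(j-k)\big)\rho(j,t).$$ A stationary solution is a function $\tilde\rho:\mathbb{N}\to[0,\infty)$ such that $\rho(j,t)=\tilde\rho(j)$ is a (time-independent) solution. *)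

theory Defs
  imports "HOL-Analysis.Analysis"
begin

text \<open>
  The positive integers are rendered as the index set \<open>{1..}\<close> of type \<^typ>\<open>nat\<close>; the values of
  \<open>\<rho>\<close> and \<open>g\<close> at \<open>0\<close> are never used. The two definitions below are the right-hand side of the
  weak form for the kernels \<open>a(j,k) = j k\<close> and \<open>b(j,k) = 1\<close>.
\<close>

definition coagulation :: "(nat \<Rightarrow> real) \<Rightarrow> (nat \<Rightarrow> real) \<Rightarrow> real" where
  "coagulation g \<rho> =
     1/2 * (\<Sum>\<^sub>\<infinity>j\<in>{1..}. \<Sum>\<^sub>\<infinity>k\<in>{1..}.
              (g (j + k) - g j - g k) * (real j * real k) * \<rho> j * \<rho> k)"

definition fragmentation :: "(nat \<Rightarrow> real) \<Rightarrow> (nat \<Rightarrow> real) \<Rightarrow> real" where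
  "fragmentation g \<rho> =
     1/2 * (\<Sum>\<^sub>\<infinity>j\<in>{1..}. \<Sum>k\<in>{1..<j}. (g j - g k - g (j - k)) * \<rho> j)"

text \<open>
  \<^const>\<open>infsum\<close> is \<open>0\<close> on families that are not summable, so the convergence of the series in the
  weak form, implicit on paper, is stated explicitly. Taking \<open>g\<close> to be the constant \<open>-1\<close> makes all
  terms of the last two series nonnegative, and \<open>g\<close> may be any choice of signs in the first, so that
  for the whole family of bounded \<open>g\<close> it is no restriction to ask for unconditional convergence.
\<close>

definition weak_form_converges :: "(nat \<Rightarrow> real) \<Rightarrow> (nat \<Rightarrow> real) \<Rightarrow> bool" where
  "weak_form_converges g \<rho> \<longleftrightarrow>
     (\<lambda>j. g j * \<rho> j) summable_on {1..} \<and>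
     (\<lambda>(j, k). (g (j + k) - g j - g k) * (real j * real k) * \<rho> j * \<rho> k)
        summable_on ({1..} \<times> {1..}) \<and>
     (\<lambda>j. \<Sum>k\<in>{1..<j}. (g j - g k - g (j - k)) * \<rho> j) summable_on {1..}"

definition cf_solution :: "(nat \<Rightarrow> real \<Rightarrow> real) \<Rightarrow> bool" where
  "cf_solution \<rho> \<longleftrightarrow>
     (\<forall>j\<ge>1. \<forall>t\<ge>0. 0 \<le> \<rho> j t) \<and>
     (\<forall>g. bounded (g ` {1..}) \<longrightarrow>
        (\<forall>t>0. weak_form_converges g (\<lambda>j. \<rho> j t) \<and>
           ((\<lambda>s. \<Sum>\<^sub>\<infinity>j\<in>{1..}. g j * \<rho> j s) has_real_derivative
              coagulation g (\<lambda>j. \<rho> j t) - fragmentation g (\<lambda>j. \<rho> j t)) (at t)))"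

definition cf_stationary_solution :: "(nat \<Rightarrow> real) \<Rightarrow> bool" where
  "cf_stationary_solution \<rho> \<longleftrightarrow> cf_solution (\<lambda>j t. \<rho> j)"

end

theory Submission
  imports Defs
begin

text \<open>
  Testing the weak form with \<open>g = 1\<close> gives \<open>m\<^sup>2 = m - P\<close>, where \<open>P\<close> is the total number
  \<open>\<Sum>j. \<rho> j\<close>. For \<open>m \<ge> 1\<close> this forces \<open>P \<le> 0\<close>, so \<open>\<rho>\<close> vanishes and \<open>m = 0\<close>.
\<close>

text \<open>For constant g = 1 every weight is 1 - 1 - 1 = -1, and the kernel j k is a product, so
  the double series factors into two first moments.\<close>

lemma coagulation_one:
  assumes "((\<lambda>l. real l * \<rho> l) has_sum m) {1..}"
  shows "coagulation (\<lambda>_. 1) \<rho> = - (m\<^sup>2 / 2)"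
proof -
  have m: "(\<Sum>\<^sub>\<infinity>l\<in>{1..}. real l * \<rho> l) = m"
    using assms by (rule infsumI)
  have inner: "(\<Sum>\<^sub>\<infinity>k\<in>{1..}. (1 - 1 - 1) * (real j * real k) * \<rho> j * \<rho> k) =
      - m * (real j * \<rho> j)" for j
  proof -
    have "(\<Sum>\<^sub>\<infinity>k\<in>{1..}. (1 - 1 - 1) * (real j * real k) * \<rho> j * \<rho> k) =
        (\<Sum>\<^sub>\<infinity>k\<in>{1..}. - (real j * \<rho> j) * (real k * \<rho> k))"
      by (intro infsum_cong) (simp add: algebra_simps)
    also have "\<dots> = - (real j * \<rho> j) * m"
      by (simp only: infsum_cmult_right' m)
    finally show ?thesis by simp
  qed
  show ?thesis
    unfolding coagulation_def inner infsum_cmult_right' m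
    by (simp add: power2_eq_square)
qed

text \<open>A cluster of size j has j - 1 ordered splittings, each of weight -1. Convergence of both
  moments allows the series of (j - 1) \<rho>(j) to be separated into m and P.\<close>

lemma fragmentation_one:
  assumes m: "((\<lambda>l. real l * \<rho> l) has_sum m) {1..}" and P: "(\<rho> has_sum P) {1..}"
  shows "fragmentation (\<lambda>_. 1) \<rho> = - ((m - P) / 2)"
proof -
  have "((\<lambda>j. - (real j * \<rho> j)) has_sum - m) {1..}"
    using m by (simp add: has_sum_uminus)
  from has_sum_add[OF this P]
  have "((\<lambda>j. - (real j * \<rho> j) + \<rho> j) has_sum - (m - P)) {1..}"
    by simp
  \<comment> \<open>The inner sum is minus the cardinality j - 1 of \<open>{1..<j}\<close> times
    \<open>\<rho> j\<close>; since j \<ge> 1, the natural subtraction is not truncated.\<close>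
  then have "((\<lambda>j. \<Sum>k\<in>{1..<j}. (1 - 1 - 1) * \<rho> j) has_sum - (m - P)) {1..}"
    by (rule has_sum_cong[THEN iffD1, rotated]) (auto simp: of_nat_diff algebra_simps)
  from infsumI[OF this] show ?thesis
    unfolding fragmentation_def by (simp add: field_simps)
qed

text \<open>Balance of the cluster number: a stationary total has derivative 0, so coagulation
  losses equal fragmentation gains. Finiteness of P is part of the weak form for g = 1.\<close>

lemma cf_stationary_solution_mass_number:
  assumes sol: "cf_stationary_solution \<rho>"
    and m: "((\<lambda>l. real l * \<rho> l) has_sum m) {1..}"
  obtains P where "(\<rho> has_sum P) {1..}" "m\<^sup>2 = m - P"
proof -
  have "bounded ((\<lambda>_. 1 :: real) ` {1 :: nat..})"
    by (simp add: image_constant_conv)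
  with sol have "\<forall>t>0. weak_form_converges (\<lambda>_. 1) \<rho> \<and>
      ((\<lambda>s :: real. \<Sum>\<^sub>\<infinity>j\<in>{1..}. 1 * \<rho> j) has_real_derivative
        coagulation (\<lambda>_. 1) \<rho> - fragmentation (\<lambda>_. 1) \<rho>) (at t)"
    unfolding cf_stationary_solution_def cf_solution_def by (elim conjE allE) (erule mp)
  from this[rule_format, OF zero_less_one]
  have conv: "weak_form_converges (\<lambda>_. 1) \<rho>"
    and deriv: "((\<lambda>s :: real. \<Sum>\<^sub>\<infinity>j\<in>{1..}. 1 * \<rho> j) has_real_derivative
      coagulation (\<lambda>_. 1) \<rho> - fragmentation (\<lambda>_. 1) \<rho>) (at 1)"
    by (rule conjunct1, rule conjunct2)
  from conv have "\<rho> summable_on {1..}"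
    unfolding weak_form_converges_def by simp
  then obtain P where P: "(\<rho> has_sum P) {1..}"
    by (auto simp: summable_on_def)
  \<comment> \<open>The differentiated sum does not depend on \<open>s\<close>, so its derivative is
    also 0.\<close>
  have "coagulation (\<lambda>_. 1) \<rho> - fragmentation (\<lambda>_. 1) \<rho> = 0"
    using deriv DERIV_const by (rule DERIV_unique)
  with coagulation_one[OF m] fragmentation_one[OF m P] have "m\<^sup>2 = m - P"
    by simp
  with P show thesis by (rule that)
qed

theorem lemma5p6:
  fixes m :: real
  assumes "m \<ge> 1"
  shows "\<not> (\<exists>\<rho> :: nat \<Rightarrow> real. cf_stationary_solution \<rho> \<and>
            ((\<lambda>l. real l * \<rho> l) has_sum m) {1..})"
proof
  assume "\<exists>\<rho> :: nat \<Rightarrow> real. cf_stationary_solution \<rho> \<and>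
            ((\<lambda>l. real l * \<rho> l) has_sum m) {1..}"
  then obtain \<rho> :: "nat \<Rightarrow> real" where sol: "cf_stationary_solution \<rho>"
    and m: "((\<lambda>l. real l * \<rho> l) has_sum m) {1..}" by blast
  have nonneg: "0 \<le> \<rho> j" if "j \<in> {1..}" for j
    using sol that unfolding cf_stationary_solution_def cf_solution_def by auto
  obtain P where P: "(\<rho> has_sum P) {1..}" and eq: "m\<^sup>2 = m - P"
    using cf_stationary_solution_mass_number[OF sol m] .
  \<comment> \<open>For 0 < m < 1 the identity would instead give P = m (1 - m) > 0, and no
    contradiction.\<close>
  from assms have "m \<le> m\<^sup>2"
    by (simp add: power2_eq_square)
  with eq have "P \<le> 0" by simp
  then have "\<rho> j = 0" if "j \<in> {1..}" for j
    using nonneg_has_sum_le_0D[OF P] nonneg that by blast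
  then have "((\<lambda>l. real l * \<rho> l) has_sum 0) {1..}"
    by (intro has_sum_0) simp
  with m have "m = 0" by (rule has_sum_unique)
  with assms show False by simp
qed

end
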